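(* Let $(a_1,\dots,a_{24})$ be the vector \[ (1,-5\beta^{2},-2\beta^{4},3\beta^{6},\beta^{8},4\beta^{10},\beta^{12},3\beta^{14},-2\beta^{16},-5\beta^{18},\beta^{20},0,\beta^{24},-5\beta^{26},-2\beta^{28},3\beta^{30},\beta^{32},4\beta^{34},\beta^{36},3\beta^{38},-2\beta^{40},-5\beta^{42},\beta^{44},0). \] Then \[ \sum_{k=0}^\infty\frac{1}{\alpha^{48k}}\sum_{j=1}^{24}\frac{a_j}{24k+j}=0. \]
   Context: $\alpha=(1+\sqrt5)/2$ is the golden ratio and $\beta=-1/\alpha=(1-\sqrt5)/2$. *)

theory Defs
  imports Complex_Main
begin

definition \<alpha> :: real where
  "\<alpha> = (1 + sqrt 5) / 2"

definition \<beta> :: real where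
  "\<beta> = - 1 / \<alpha>"

lemma \<beta>_eq: "\<beta> = (1 - sqrt 5) / 2"
proof -
  have "(1 + sqrt 5) * (1 - sqrt 5) = -4" "1 + sqrt 5 > 0"
    by (simp_all add: algebra_simps add_pos_nonneg)
  then show ?thesis
    unfolding \<beta>_def \<alpha>_def by (simp add: field_simps)
qed

definition coeffs24 :: "real list" where
  "coeffs24 =
    [1, - 5 * \<beta>^2, - 2 * \<beta>^4, 3 * \<beta>^6, \<beta>^8, 4 * \<beta>^10, \<beta>^12, 3 * \<beta>^14,
     - 2 * \<beta>^16, - 5 * \<beta>^18, \<beta>^20, 0,
     \<beta>^24, - 5 * \<beta>^26, - 2 * \<beta>^28, 3 * \<beta>^30, \<beta>^32, 4 * \<beta>^34, \<beta>^36, 3 * \<beta>^38,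
     - 2 * \<beta>^40, - 5 * \<beta>^42, \<beta>^44, 0]"

lemma length_coeffs24: "length coeffs24 = 24"
  by (simp add: coeffs24_def)

(* List positions start at 0, so the j-th entry of the vector (1 \<le> j \<le> 24) is at position j - 1. *)
definition a :: "nat \<Rightarrow> real" where
  "a j = coeffs24 ! (j - 1)"

end

theory Submission
  imports Defs "HOL-Analysis.Complex_Transcendental"
begin

text \<open>
  With \<open>x = \<beta>\<^sup>2 = \<alpha>\<^sup>-\<^sup>2\<close> the series is \<open>x\<^sup>-\<^sup>1 \<Sum> c n x\<^sup>n / n\<close> read off in blocks of length 24, where \<open>c n\<close>
  depends only on \<open>gcd n 12\<close>. Expanding \<open>c\<close> in the indicators of \<open>d dvd n\<close> for \<open>d dvd 12\<close> turns the sum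
  into a combination of the logarithms \<open>ln (1 - x\<^sup>d)\<close>, which vanishes because of the identity
  \<open>(1 - x) (1 - x\<^sup>4)\<^sup>2 (1 - x\<^sup>6)\<^sup>2 = (1 - x\<^sup>2)\<^sup>3 (1 - x\<^sup>3) (1 - x\<^sup>1\<^sup>2)\<close>, valid since \<open>x\<^sup>2 = 3 x - 1\<close>.
\<close>

text \<open>The Mercator series at \<open>x ^ d\<close>, divided by \<open>- d\<close>, has terms
  \<open>x ^ (d * n) / (d * n)\<close>; these are then spread over the multiples of
  \<open>d\<close>.\<close>

lemma sums_ln_one_minus_power:
  fixes x :: real
  assumes "\<bar>x\<bar> < 1" "d > 0"
  shows "(\<lambda>n. of_bool (d dvd n) * (x ^ n / real n)) sums (- ln (1 - x ^ d) / real d)"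
proof -
  have "\<bar>- (x ^ d)\<bar> < 1"
    using assms by (simp add: power_abs power_less_one_iff)
  then have "(\<lambda>n. - ((x ^ d) ^ n) / real n) sums ln (1 - x ^ d)"
    using ln_series'[of "- (x ^ d)"] by simp
  then have "(\<lambda>n. - 1 / real d * (- ((x ^ d) ^ n) / real n)) sums (- 1 / real d * ln (1 - x ^ d))"
    by (rule sums_mult)
  then have "(\<lambda>n. of_bool (d dvd d * n) * (x ^ (d * n) / real (d * n))) sums (- ln (1 - x ^ d) / real d)"
    by (simp add: power_mult)
  moreover have "strict_mono (\<lambda>n. d * n)"
    using assms by (simp add: strict_mono_def)
  moreover have "of_bool (d dvd n) * (x ^ n / real n) = 0" if "n \<notin> range (\<lambda>n. d * n)" for n
    using that by (auto simp: dvd_def)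
  ultimately show ?thesis
    using sums_mono_reindex[of "\<lambda>n. d * n" "\<lambda>n. of_bool (d dvd n) * (x ^ n / real n)"] by blast
qed

lemma \<beta>_square_root: "(\<beta>\<^sup>2)\<^sup>2 = 3 * \<beta>\<^sup>2 - 1"
proof -
  have "\<beta>\<^sup>2 = \<beta> + 1"
    by (simp add: \<beta>_eq power2_eq_square field_simps)
  then show ?thesis
    by algebra
qed

lemma \<beta>_square_bounds: "0 < \<beta>\<^sup>2" "\<beta>\<^sup>2 < 1"
proof -
  have "\<alpha> > 1"
    unfolding \<alpha>_def by (simp add: real_less_rsqrt)
  then show "0 < \<beta>\<^sup>2" "\<beta>\<^sup>2 < 1"
    by (simp_all add: \<beta>_def power_divide one_less_power)
qed

text \<open>The values are 1, -5, -2, 3, 4, 0 for \<open>gcd n 12\<close> equal to 1, 2, 3, 4, 6,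
  12; Moebius inversion over the divisors of 12 gives the weights.\<close>

definition c :: "nat \<Rightarrow> real" where
  "c n = of_bool (1 dvd n) - 6 * of_bool (2 dvd n) - 3 * of_bool (3 dvd n)
       + 8 * of_bool (4 dvd n) + 12 * of_bool (6 dvd n) - 12 * of_bool (12 dvd n)"

lemma c_add_24: "c (24 * k + j) = c j"
proof -
  have "d dvd 24 * k + j \<longleftrightarrow> d dvd j" if "d dvd 24" for d
    using that by (simp add: dvd_add_right_iff)
  then show ?thesis
    by (simp add: c_def)
qed

text \<open>The factor \<open>\<beta>\<^sup>2\<close> is there because \<open>a j\<close> carries
  the exponent 2(j - 1), not 2j. The 24 cases are checked one by one.\<close>

lemma a_eq_c:
  assumes "j \<in> {1..24}"
  shows "a j * \<beta>\<^sup>2 = c j * (\<beta>\<^sup>2) ^ j"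
proof -
  have interval: "{1..24 :: nat} =
      {1, 2, 3, 4, 5, 6, 7, 8, 9, 10, 11, 12, 13, 14, 15, 16, 17, 18, 19, 20, 21, 22, 23, 24}"
    by (simp add: atLeastAtMost_upt upt_rec eval_nat_numeral)
  have "\<forall>j \<in> {1..24}. a j * \<beta>\<^sup>2 = c j * (\<beta>\<^sup>2) ^ j"
    unfolding interval
    by (simp add: a_def coeffs24_def c_def mult.assoc flip: power_mult power_add power_Suc2)
  with assms show ?thesis by blast
qed

text \<open>The coefficient of \<open>ln (1 - x ^ d)\<close> is the weight of \<open>d dvd n\<close>
  in \<open>c\<close>, divided by \<open>d\<close>.\<close>

lemma ln_relation:
  fixes x :: real
  assumes "0 < x" "x < 1" "x\<^sup>2 = 3 * x - 1"
  shows "ln (1 - x) - 3 * ln (1 - x ^ 2) - ln (1 - x ^ 3)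
       + 2 * ln (1 - x ^ 4) + 2 * ln (1 - x ^ 6) - ln (1 - x ^ 12) = 0"
proof -
  have pos: "1 - x ^ d > 0" if "d > 0" for d
    using assms that by (simp add: power_less_one_iff)
  \<comment> \<open>Reduction modulo the quadratic gives x^n = F(2n) x - F(2n-2) with Fibonacci
    numbers F.\<close>
  have p3: "x ^ 3 = 8 * x - 3"
    using assms(3) by algebra
  have p4: "x ^ 4 = 21 * x - 8"
    using assms(3) by algebra
  have p6: "x ^ 6 = 144 * x - 55"
    using assms(3) p3 by algebra
  have p12: "x ^ 12 = 46368 * x - 17711"
    using assms(3) p6 by algebra
  have "(1 - x) * (1 - x ^ 4)\<^sup>2 * (1 - x ^ 6)\<^sup>2 = (1 - x ^ 2) ^ 3 * (1 - x ^ 3) * (1 - x ^ 12)"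
    unfolding p3 p4 p6 p12 using assms(3) by algebra
  then have "ln ((1 - x) * (1 - x ^ 4)\<^sup>2 * (1 - x ^ 6)\<^sup>2) = ln ((1 - x ^ 2) ^ 3 * (1 - x ^ 3) * (1 - x ^ 12))"
    by simp
  then show ?thesis
    using pos[of 1] pos[of 2] pos[of 3] pos[of 4] pos[of 6] pos[of 12]
    by (simp add: ln_mult ln_realpow)
qed

lemma c_series_sums_0: "(\<lambda>n. c n * ((\<beta>\<^sup>2) ^ n / real n)) sums 0"
proof -
  define x where "x = \<beta>\<^sup>2"
  have x: "0 < x" "x < 1" "x\<^sup>2 = 3 * x - 1" "\<bar>x\<bar> < 1"
    using \<beta>_square_bounds \<beta>_square_root by (simp_all add: x_def)
  define f where "f d n = of_bool (d dvd n) * (x ^ n / real n)" for d n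
  define L where "L d = - ln (1 - x ^ d) / real d" for d
  have f: "f d sums L d" if "d > 0" for d
    unfolding f_def L_def using sums_ln_one_minus_power x(4) that by blast
  have "(\<lambda>n. f 1 n - 6 * f 2 n - 3 * f 3 n + 8 * f 4 n + 12 * f 6 n - 12 * f 12 n)
      sums (L 1 - 6 * L 2 - 3 * L 3 + 8 * L 4 + 12 * L 6 - 12 * L 12)"
    by (intro sums_add sums_diff sums_mult f) simp_all
  moreover have "f 1 n - 6 * f 2 n - 3 * f 3 n + 8 * f 4 n + 12 * f 6 n - 12 * f 12 n
      = c n * (x ^ n / real n)" for n
    unfolding f_def c_def by (simp only: algebra_simps)
  \<comment> \<open>The left side is the negative of the one in \<open>ln_relation\<close>.\<close>
  moreover have "L 1 - 6 * L 2 - 3 * L 3 + 8 * L 4 + 12 * L 6 - 12 * L 12 = 0"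
    using ln_relation[OF x(1-3)] by (simp add: L_def)
  ultimately show ?thesis
    by (simp add: x_def)
qed

theorem theorem4p2:
  shows "(\<lambda>k::nat. 1 / \<alpha> ^ (48 * k) * (\<Sum>j = 1..24. a j / real (24 * k + j))) sums 0"
proof -
  define g where "g n = c n * ((\<beta>\<^sup>2) ^ n / real n) / \<beta>\<^sup>2" for n
  have "g sums 0"
    unfolding g_def using sums_divide[OF c_series_sums_0] by simp
  \<comment> \<open>Dropping \<open>g 0\<close>, which is 0 as division by 0 gives 0, makes block
    \<open>k\<close> run over the indices 24k + 1 to 24k + 24.\<close>
  then have "(\<lambda>n. g (Suc n)) sums 0"
    using sums_Suc_iff[of g 0] by (simp add: g_def[of 0])
  then have "(\<lambda>k. \<Sum>n = k * 24..<k * 24 + 24. g (Suc n)) sums 0"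
    by (rule sums_group) simp
  moreover have "(\<Sum>n = k * 24..<k * 24 + 24. g (Suc n))
      = 1 / \<alpha> ^ (48 * k) * (\<Sum>j = 1..24. a j / real (24 * k + j))" for k
  proof -
    have "(\<Sum>n = k * 24..<k * 24 + 24. g (Suc n)) = (\<Sum>j = 1..24. g (24 * k + j))"
      by (rule sum.reindex_bij_witness[of _ "\<lambda>j. 24 * k + j - 1" "\<lambda>n. Suc n - 24 * k"]) auto
    also have "\<dots> = (\<Sum>j = 1..24. 1 / \<alpha> ^ (48 * k) * (a j / real (24 * k + j)))"
    proof (rule sum.cong)
      fix j :: nat assume j: "j \<in> {1..24}"
      \<comment> \<open>By the periodicity of \<open>c\<close>, this power is all that distinguishes
        the numerators of block \<open>k\<close> from those of block 0.\<close>
      have "(\<beta>\<^sup>2) ^ (24 * k) = 1 / \<alpha> ^ (48 * k)"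
        by (simp add: \<beta>_def power_divide flip: power_mult)
      moreover have "c j * (\<beta>\<^sup>2) ^ j / \<beta>\<^sup>2 = a j"
        using \<beta>_square_bounds(1) by (simp flip: a_eq_c[OF j])
      moreover have "g (24 * k + j) = (\<beta>\<^sup>2) ^ (24 * k) * (c j * (\<beta>\<^sup>2) ^ j / \<beta>\<^sup>2 / real (24 * k + j))"
        by (simp only: g_def c_add_24 power_add) (simp add: mult_ac)
      ultimately show "g (24 * k + j) = 1 / \<alpha> ^ (48 * k) * (a j / real (24 * k + j))"
        by simp
    qed simp
    finally show ?thesis
      by (simp only: sum_distrib_left)
  qed
  ultimately show ?thesis
    by simp
qed

end
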